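(* Let $m,n\in\mathbb{N}$. For any nonresonant matrix $\Lambda\in\mathbb{R}^{m\times n}$ and any Jordan measurable set $G\subset\mathbb{R}^m$, the set $Q_m(G,\Lambda)=\{x\in\mathbb{Z}^n:\ \Lambda x\in G+\mathbb{Z}^m\}$ is frequency measurable, and its frequency is $$\mathbf{F}(Q_m(G,\Lambda))=\mathrm{mes}_m\big(V\cap(G+\mathbb{Z}^m)\big),$$ where $V\subset\mathbb{R}^m$ is an arbitrary Lebesgue measurable cell.
   Context: $\mathbb{N}=\{1,2,3,\ldots\}$ and $\mathrm{mes}_m$ is the $m$-dimensional Lebesgue measure. For $a\in\mathbb{Z}^n$ and $\ell\in\mathbb{N}^n$ let $P_{a,\ell}=\{x\in\mathbb{Z}^n:\ a_k\le x_k<a_k+\ell_k \text{ for all }1\le k\le n\}$, and for $N\in\mathbb{N}$ let $\mathcal{P}_N=\{P_{a,\ell}:\ a\in\mathbb{Z}^n,\ \ell\in\mathbb{N}^n,\ \min_k\ell_k\ge N\}$. For $A\subset\mathbb{Z}^n$ put $\mathbf{F}_*(A)=\sup_{N\ge1}\inf_{P\in\mathcal{P}_N}\frac{\#(A\cap P)}{\#P}$ and $\mathbf{F}^*(A)=\inf_{N\ge1}\sup_{P\in\mathcal{P}_N}\frac{\#(A\cap P)}{\#P}$. The set $A$ is frequency measurable if $\mathbf{F}_*(A)=\mathbf{F}^*(A)$; the common value is the frequency $\mathbf{F}(A)$. A matrix $\Lambda\in\mathbb{R}^{m\times n}$ is nonresonant if the $n+m$ rows of the matrix $\begin{bmatrix}I_n\\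 \Lambda\end{bmatrix}$ are linearly independent over the field of rationals. A set $V\subset\mathbb{R}^m$ is a cell if its translations $V+z$, $z\in\mathbb{Z}^m$, form a partition of $\mathbb{R}^m$. A Jordan measurable set is a bounded set whose boundary has zero Lebesgue measure. *)

theory Defs
  imports "HOL-Analysis.Analysis" "HOL-Library.Set_Algebras"
begin

definition int_vec :: "int ^ 'n \<Rightarrow> real ^ 'n"
  where "int_vec z = (\<chi> k. of_int (z $ k))"

definition int_box :: "int ^ 'n \<Rightarrow> nat ^ 'n \<Rightarrow> (int ^ 'n) set"
  where "int_box a l = {x. \<forall>k. a $ k \<le> x $ k \<and> x $ k < a $ k + int (l $ k)}"

text \<open>For \<open>N \<ge> 1\<close> the bound on the side lengths also makes them positive.\<close>

definition int_boxes :: "nat \<Rightarrow> (int ^ 'n) set set"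
  where "int_boxes N = {int_box a l | a l. \<forall>k. N \<le> l $ k}"

definition density_in :: "(int ^ 'n) set \<Rightarrow> (int ^ 'n) set \<Rightarrow> real"
  where "density_in A P = real (card (A \<inter> P)) / real (card P)"

text \<open>
  The suprema and infima are those of the conditionally complete order of the reals; they range over
  nonempty families with values in \<open>{0..1}\<close>, so they are the true ones.
\<close>

definition lower_frequency :: "(int ^ 'n) set \<Rightarrow> real"
  where "lower_frequency A = (SUP N\<in>{1..}. INF P\<in>int_boxes N. density_in A P)"

definition upper_frequency :: "(int ^ 'n) set \<Rightarrow> real"
  where "upper_frequency A = (INF N\<in>{1..}. SUP P\<in>int_boxes N. density_in A P)"

definition frequency_measurable :: "(int ^ 'n) set \<Rightarrow> bool"
  where "frequency_measurable A \<longleftrightarrow> lower_frequency A = upper_frequency A"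

text \<open>Meaningful only for frequency measurable sets, where it is the common value.\<close>

definition frequency :: "(int ^ 'n) set \<Rightarrow> real"
  where "frequency A = lower_frequency A"

definition stack_id :: "real ^ 'n ^ 'm \<Rightarrow> real ^ 'n ^ ('n + 'm)"
  where "stack_id L = (\<chi> i. case i of Inl j \<Rightarrow> row j (mat 1) | Inr k \<Rightarrow> row k L)"

abbreviation rat_scale :: "rat \<Rightarrow> 'a::real_vector \<Rightarrow> 'a"
  where "rat_scale q v \<equiv> of_rat q *\<^sub>R v"

text \<open>
  The rows are independent as a family, i.e. with repetitions counted, whereas the library notion
  concerns sets; hence the injectivity clause.
\<close>

definition nonresonant :: "real ^ 'n ^ 'm \<Rightarrow> bool"
  where "nonresonant L \<longleftrightarrow>
    inj (\<lambda>i. row i (stack_id L)) \<and> \<not> module.dependent rat_scale (rows (stack_id L))"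

lemma vector_space_rat_scale: "vector_space (rat_scale :: rat \<Rightarrow> 'a::real_vector \<Rightarrow> 'a)"
  by unfold_locales (simp_all add: algebra_simps of_rat_add of_rat_mult)

lemma nonresonant_iff:
  fixes L :: "real ^ 'n ^ 'm"
  shows "nonresonant L \<longleftrightarrow>
    (\<forall>c. (\<Sum>i\<in>UNIV. rat_scale (c i) (row i (stack_id L))) = 0 \<longrightarrow> (\<forall>i. c i = 0))"
    (is "_ \<longleftrightarrow> (\<forall>c. ?S c = 0 \<longrightarrow> _)")
proof -
  interpret V: vector_space "rat_scale :: rat \<Rightarrow> real ^ 'n \<Rightarrow> real ^ 'n"
    by (rule vector_space_rat_scale)
  let ?r = "\<lambda>i. row i (stack_id L)"
  have rows: "rows (stack_id L) = range ?r"
    by (auto simp: rows_def)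
  have fin: "finite (range ?r)" by simp
  have reindex: "(\<Sum>v\<in>range ?r. rat_scale (u v) v) = ?S (\<lambda>i. u (?r i))" if "inj ?r" for u
    using that by (simp add: sum.reindex)
  show ?thesis
  proof
    assume n: "nonresonant L"
    then have inj: "inj ?r" and ind: "\<not> V.dependent (range ?r)"
      by (auto simp: nonresonant_def rows)
    show "\<forall>c. ?S c = 0 \<longrightarrow> (\<forall>i. c i = 0)"
    proof (intro allI impI)
      fix c i assume "?S c = 0"
      then have "(\<Sum>v\<in>range ?r. rat_scale (c (inv ?r v)) v) = 0"
        using inj by (simp add: reindex inv_f_f[OF inj])
      then have "c (inv ?r (?r i)) = 0"
        using ind unfolding V.dependent_finite[OF fin] by (meson rangeI)
      then show "c i = 0" by (simp add: inv_f_f[OF inj])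
    qed
  next
    assume H: "\<forall>c. ?S c = 0 \<longrightarrow> (\<forall>i. c i = 0)"
    have inj: "inj ?r"
    proof (rule injI, rule ccontr)
      fix i j assume e: "?r i = ?r j" and ne: "i \<noteq> j"
      let ?c = "\<lambda>k. if k = i then 1 else if k = j then - 1 else (0::rat)"
      have "?S ?c = (\<Sum>k\<in>{i, j}. rat_scale (?c k) (?r k))"
        by (rule sum.mono_neutral_right) auto
      also have "\<dots> = 0" using e ne by simp
      finally have "?S ?c = 0" .
      from H[rule_format, of ?c i, OF this] show False by simp
    qed
    have "\<not> V.dependent (range ?r)"
      unfolding V.dependent_finite[OF fin] using H reindex[OF inj] by auto
    then show "nonresonant L" using inj by (simp add: nonresonant_def rows)
  qed
qed

text \<open>The translates form an indexed partition: distinct vectors \<open>z\<close> give disjoint translates.\<close>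

definition cell :: "(real ^ 'm) set \<Rightarrow> bool"
  where "cell V \<longleftrightarrow>
    disjoint_family (\<lambda>z. (+) (int_vec z) ` V) \<and> (\<Union>z. (+) (int_vec z) ` V) = UNIV"

definition Jordan_measurable :: "'a::euclidean_space set \<Rightarrow> bool"
  where "Jordan_measurable G \<longleftrightarrow> bounded G \<and> frontier G \<in> null_sets lebesgue"

definition Q_set :: "(real ^ 'm) set \<Rightarrow> real ^ 'n ^ 'm \<Rightarrow> (int ^ 'n) set"
  where "Q_set G L = {x. L *v int_vec x \<in> G + range int_vec}"

end

theory Submission
  imports Defs "HOL-Real_Asymp.Real_Asymp"
begin

text \<open>
  Replacing \<open>A\<close> by a translate \<open>A + y\<close> changes its density in a box with sides at least \<open>N\<close> by
  \<open>O(1 / N)\<close>. By nonresonance \<open>\<Lambda> \<int>\<^sup>n + \<int>\<^sup>m\<close> is dense in \<open>\<real>\<^sup>m\<close>, so a cube can be moved by some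
  \<open>\<Lambda> y + z\<close> into any slightly larger cube, and hence its visits are not more frequent up to
  \<open>O(1 / N)\<close>. Comparing the \<open>K\<^sup>m\<close> grid cubes of side \<open>1 / K\<close> in \<open>[0, 1)\<^sup>m\<close> with those of
  sides \<open>1 / (K + 1)\<close> and \<open>1 / (K - 1)\<close>, whose densities add up to 1, bounds each density between
  \<open>(K + 1)\<^sup>-\<^sup>m\<close> and \<open>(K - 1)\<^sup>-\<^sup>m\<close> up to \<open>O(1 / N)\<close>. A Jordan measurable set is squeezed
  between unions of grid cubes.

  The density of \<open>\<Lambda> \<int>\<^sup>n + \<int>\<^sup>m\<close> is Kronecker's theorem: if \<open>\<Lambda> x\<close> avoids a neighbourhood of \<open>\<alpha>\<close>
  modulo \<open>\<int>\<^sup>m\<close>, then \<open>\<Prod>\<^sub>k cos\<^sup>2\<^sup>p (\<pi> (\<Lambda> x - \<alpha>)\<^sub>k)\<close> decays exponentially in \<open>p\<close>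
  uniformly in \<open>x\<close>, whereas its mean over \<open>x\<close> is the constant Fourier coefficient, which decays only
  polynomially.
\<close>

subsection \<open>Density of the orbit\<close>

text \<open>The summation runs over \<open>PiE\<close> instead of an \<open>int_box\<close> so that
  \<open>prod_sum_PiE\<close> can factor the mean of a product of functions of single coordinates.
  At \<open>N = 0\<close> the value is 0.\<close>

definition cube_mean :: "(int ^ 'n \<Rightarrow> complex) \<Rightarrow> nat \<Rightarrow> complex"
  where "cube_mean g N =
    (\<Sum>f\<in>PiE UNIV (\<lambda>_. {..<N}). g (\<chi> i. int (f i))) / of_nat N ^ CARD('n)"

lemma cube_mean_sum:
  "cube_mean (\<lambda>x. \<Sum>j\<in>S. c j * g j x) N = (\<Sum>j\<in>S. c j * cube_mean (g j) N)"
  unfolding cube_mean_def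
  by (subst sum.swap) (simp add: sum_divide_distrib sum_distrib_left)

lemma cube_mean_const:
  assumes "N > 0"
  shows "cube_mean (\<lambda>x::int ^ 'n. c) N = c"
  using assms by (simp add: cube_mean_def card_PiE)

lemma norm_cube_mean_le:
  fixes g :: "int ^ 'n \<Rightarrow> complex"
  assumes "\<And>x. norm (g x) \<le> b" "N > 0"
  shows "norm (cube_mean g N) \<le> b"
proof -
  have "norm (\<Sum>f\<in>PiE UNIV (\<lambda>_::'n. {..<N}). g (\<chi> i. int (f i))) \<le>
      of_nat (card (PiE UNIV (\<lambda>_::'n. {..<N}))) * b"
    by (rule sum_norm_bound) (rule assms)
  then show ?thesis
    using assms(2) by (simp add: cube_mean_def card_PiE norm_divide norm_power field_simps)
qed

lemma cis_sum: "cis (\<Sum>i\<in>A. f i) = (\<Prod>i\<in>A. cis (f i))"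
  by (induction A rule: infinite_finite_induct) (simp_all flip: cis_mult)

lemma cis_2pi_eq_1_imp_Ints:
  assumes "cis (2 * pi * w) = 1"
  shows "w \<in> \<int>"
proof -
  from assms have "cos (2 * pi * w) = 1"
    by (metis cis.sel(1) one_complex.sel(1))
  then obtain k :: int where "2 * pi * w = of_int k * 2 * pi"
    by (auto simp: cos_one_2pi_int)
  then have "w = of_int k" by (simp add: field_simps)
  then show ?thesis by simp
qed

text \<open>The mean factors into one-dimensional means of geometric progressions. All have norm at
  most 1, and the one in coordinate \<open>i0\<close>, whose ratio differs from 1, is O(1 /
  N).\<close>

lemma cube_mean_character_tendsto_0:
  fixes w :: "real ^ 'n"
  assumes "w $ i0 \<notin> \<int>"
  shows "cube_mean (\<lambda>x. cis (2 * pi * (\<Sum>i\<in>UNIV. w $ i * of_int (x $ i)))) \<longlonglongrightarrow> 0"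
proof -
  define \<zeta> where "\<zeta> i = cis (2 * pi * w $ i)" for i
  have ne: "\<zeta> i0 \<noteq> 1"
    using assms cis_2pi_eq_1_imp_Ints unfolding \<zeta>_def by blast
  have n1: "norm (\<zeta> i) = 1" for i by (simp add: \<zeta>_def)
  have eq: "cube_mean (\<lambda>x. cis (2 * pi * (\<Sum>i\<in>UNIV. w $ i * of_int (x $ i)))) N
      = (\<Prod>i\<in>UNIV. (\<Sum>k<N. \<zeta> i ^ k) / of_nat N)" for N
  proof -
    have "cis (2 * pi * (\<Sum>i\<in>UNIV. w $ i * real (f i))) = (\<Prod>i\<in>UNIV. \<zeta> i ^ f i)" for f
      unfolding \<zeta>_def Complex.DeMoivre sum_distrib_left cis_sum by (simp only: mult_ac)
    then show ?thesis
      by (simp add: cube_mean_def prod_dividef prod_sum_PiE)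
  qed
  have bd: "norm (\<Prod>i\<in>UNIV. (\<Sum>k<N. \<zeta> i ^ k) / of_nat N) \<le> (2 / norm (1 - \<zeta> i0)) / real N" for N
  proof (cases "N = 0")
    case False
    have le1: "norm ((\<Sum>k<N. \<zeta> i ^ k) / of_nat N) \<le> 1" for i
    proof -
      have "norm (\<Sum>k<N. \<zeta> i ^ k) \<le> of_nat (card {..<N}) * 1"
        by (rule sum_norm_bound) (simp add: norm_power n1)
      then show ?thesis using False by (simp add: norm_divide)
    qed
    \<comment> \<open>The geometric sum equals (1 - \<open>\<zeta> i0 ^ N\<close>) / (1 -
      \<open>\<zeta> i0\<close>), which is bounded independently of \<open>N\<close>.\<close>
    have "norm (1 - \<zeta> i0 ^ N) \<le> 2"
      using norm_triangle_ineq4[of 1 "\<zeta> i0 ^ N"] by (simp add: norm_power n1)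
    then have "norm (\<Sum>k<N. \<zeta> i0 ^ k) \<le> 2 / norm (1 - \<zeta> i0)"
      using ne by (simp add: sum_gp_strict norm_divide divide_right_mono)
    then have *: "norm ((\<Sum>k<N. \<zeta> i0 ^ k) / of_nat N) \<le> (2 / norm (1 - \<zeta> i0)) / real N"
      unfolding norm_divide norm_of_nat by (rule divide_right_mono) simp
    have "norm (\<Prod>i\<in>UNIV. (\<Sum>k<N. \<zeta> i ^ k) / of_nat N)
       = norm ((\<Sum>k<N. \<zeta> i0 ^ k) / of_nat N) * (\<Prod>i\<in>UNIV-{i0}. norm ((\<Sum>k<N. \<zeta> i ^ k) / of_nat N))"
      unfolding prod_norm[symmetric] by (subst prod.remove[of _ i0]) simp_all
    also have "\<dots> \<le> norm ((\<Sum>k<N. \<zeta> i0 ^ k) / of_nat N) * 1"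
      by (intro mult_left_mono prod_le_1) (use le1 in auto)
    finally show ?thesis using * by simp
  qed simp
  have "(\<lambda>N. (2 / norm (1 - \<zeta> i0)) / real N) \<longlonglongrightarrow> 0"
    by (rule lim_const_over_n)
  then show ?thesis
    unfolding eq by (rule Lim_null_comparison[rotated]) (intro always_eventually allI bd)
qed

text \<open>An integral combination of the rows of \<open>L\<close> with integer entries
  \<open>w i\<close> is cancelled by \<open>- w i\<close> times the unit rows. This is a rational
  relation among the rows of \<open>stack_id L\<close>, so all its coefficients vanish.\<close>

lemma nonresonant_combination:
  fixes L :: "real ^ 'n ^ 'm" and q :: "'m \<Rightarrow> int"
  assumes "nonresonant L" "\<And>i. (\<Sum>k\<in>UNIV. of_int (q k) * L $ k $ i) \<in> \<int>"
  shows "q k = 0"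
proof -
  obtain w :: "'n \<Rightarrow> int" where w: "\<And>i. (\<Sum>k\<in>UNIV. of_int (q k) * L $ k $ i) = of_int (w i)"
    using assms(2) unfolding Ints_def by (auto simp: image_iff) metis
  define c :: "'n + 'm \<Rightarrow> rat"
    where "c = case_sum (\<lambda>i. - of_int (w i)) (\<lambda>k. of_int (q k))"
  have "(\<Sum>i\<in>UNIV. rat_scale (c i) (row i (stack_id L))) = 0"
  proof (simp only: vec_eq_iff, rule allI)
    fix i
    have "(\<Sum>j\<in>UNIV. rat_scale (c j) (row j (stack_id L))) $ i
       = (\<Sum>j\<in>UNIV <+> UNIV. of_rat (c j) * (stack_id L $ j $ i))"
      by (simp add: row_def)
    also have "\<dots> = (\<Sum>j\<in>UNIV. of_int (- w j) * (if j = i then 1 else 0))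
        + (\<Sum>k\<in>UNIV. of_int (q k) * L $ k $ i)"
      by (subst sum.Plus) (auto simp: c_def stack_id_def row_def mat_def of_rat_minus)
    also have "\<dots> = 0"
      by (simp add: w if_distrib[of "(*) _"] cong: if_cong)
    finally show "(\<Sum>j\<in>UNIV. rat_scale (c j) (row j (stack_id L))) $ i = (0::real ^ 'n) $ i"
      by simp
  qed
  then have "c (Inr k) = 0"
    using assms(1) unfolding nonresonant_iff by blast
  then show ?thesis by (simp add: c_def)
qed

section \<open>Fourier expansion of the cosine kernel and its mean along the orbit\<close>

lemma cos_power_expansion:
  "of_real (cos (pi * u) ^ (2 * p)) =
    (\<Sum>j\<le>2 * p. of_real (real (2 * p choose j) / 4 ^ p) * cis (2 * pi * ((real j - real p) * u)))"
proof -
  have c: "of_real (cos (pi * u)) = (cis (pi * u) + cis (- (pi * u))) / 2"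
    by (simp add: complex_eq_iff)
  have "of_real (cos (pi * u) ^ (2 * p)) = (cis (pi * u) + cis (- (pi * u))) ^ (2 * p) / 4 ^ p"
    by (simp only: of_real_power c power_divide power_mult) simp
  \<comment> \<open>The binomial theorem for the sum of the two conjugate exponentials.\<close>
  also have "\<dots> = (\<Sum>j\<le>2 * p. of_nat (2 * p choose j) * cis (pi * u) ^ j *
      cis (- (pi * u)) ^ (2 * p - j)) / 4 ^ p"
    by (simp add: binomial_ring)
  also have "\<dots> = (\<Sum>j\<le>2 * p. of_real (real (2 * p choose j) / 4 ^ p) *
      cis (2 * pi * ((real j - real p) * u)))"
    unfolding sum_divide_distrib
  proof (rule sum.cong[OF refl])
    fix j assume "j \<in> {..2 * p}"
    then have "real j * (pi * u) + real (2 * p - j) * - (pi * u) =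
        2 * pi * ((real j - real p) * u)"
      by (simp add: of_nat_diff algebra_simps)
    then have "cis (pi * u) ^ j * cis (- (pi * u)) ^ (2 * p - j) =
        cis (2 * pi * ((real j - real p) * u))"
      by (simp only: Complex.DeMoivre cis_mult)
    then show "of_nat (2 * p choose j) * cis (pi * u) ^ j * cis (- (pi * u)) ^ (2 * p - j) / 4 ^ p
      = of_real (real (2 * p choose j) / 4 ^ p) * cis (2 * pi * ((real j - real p) * u))"
      by (simp add: mult.assoc)
  qed
  finally show ?thesis .
qed

text \<open>The even exponent makes every frequency vector \<open>J k - p\<close> integral, as
  needed for \<open>nonresonant_combination\<close>. The constant term is the one with
  \<open>J k = p\<close> for all \<open>k\<close>.\<close>

lemma cos_prod_expansion:
  fixes u :: "'m::finite \<Rightarrow> real"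
  shows "of_real (\<Prod>k\<in>UNIV. cos (pi * u k) ^ (2 * p)) =
    (\<Sum>J\<in>PiE UNIV (\<lambda>_. {..2 * p}). of_real (\<Prod>k\<in>UNIV. real (2 * p choose J k) / 4 ^ p) *
      cis (2 * pi * (\<Sum>k\<in>UNIV. (real (J k) - real p) * u k)))"
proof -
  have "cis (2 * pi * (\<Sum>k\<in>UNIV. (real (J k) - real p) * u k)) =
      (\<Prod>k\<in>UNIV. cis (2 * pi * ((real (J k) - real p) * u k)))" for J :: "'m \<Rightarrow> nat"
    unfolding sum_distrib_left cis_sum ..
  then show ?thesis
    unfolding of_real_prod cos_power_expansion
    by (subst prod_sum_PiE) (simp_all only: prod.distrib finite_atMost finite)
qed

lemma matrix_vector_int_vec:
  "(L *v int_vec x) $ k = (\<Sum>i\<in>UNIV. L $ k $ i * of_int (x $ i))"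
  by (simp add: matrix_vector_mult_def int_vec_def)

text \<open>Each nonconstant term of the expansion is, up to a unimodular factor, a character of
  \<open>x\<close> with some non-integral frequency by nonresonance, so its mean tends to 0. Only
  the product of the central binomial coefficients survives.\<close>

lemma cube_mean_cos_prod_tendsto:
  fixes L :: "real ^ 'n ^ 'm" and \<alpha> :: "real ^ 'm"
  assumes "nonresonant L"
  shows "cube_mean (\<lambda>x. of_real (\<Prod>k\<in>UNIV. cos (pi * (L *v int_vec x - \<alpha>) $ k) ^ (2 * p)))
    \<longlonglongrightarrow> of_real ((real (2 * p choose p) / 4 ^ p) ^ CARD('m))"
proof -
  let ?S = "PiE (UNIV::'m set) (\<lambda>_. {..2 * p})"
  let ?e = "\<lambda>J x. cis (2 * pi * (\<Sum>k\<in>UNIV. (real (J k) - real p) * (L *v int_vec x - \<alpha>) $ k))"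
  let ?c = "\<lambda>J. complex_of_real (\<Prod>k\<in>(UNIV::'m set). real (2 * p choose J k) / 4 ^ p)"
  have lim: "cube_mean (?e J) \<longlonglongrightarrow> (if J = (\<lambda>_. p) then 1 else 0)" for J
  proof (cases "J = (\<lambda>_. p)")
    case True
    then have "eventually (\<lambda>N. cube_mean (?e J) N = 1) sequentially"
      by (auto intro!: eventually_sequentiallyI[of 1] simp: cube_mean_const)
    then show ?thesis using True by (simp add: tendsto_eventually)
  next
    case False
    define q where "q k = int (J k) - int p" for k
    define w :: "real ^ 'n" where "w = (\<chi> i. \<Sum>k\<in>UNIV. of_int (q k) * L $ k $ i)"
    define b where "b = (\<Sum>k\<in>UNIV. of_int (q k) * \<alpha> $ k)"
    obtain k where "q k \<noteq> 0" using False by (auto simp: q_def)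
    then obtain i where i: "w $ i \<notin> \<int>"
      using nonresonant_combination[OF assms, of q k] by (auto simp: w_def)
    \<comment> \<open>The sum over a singleton lets \<open>cube_mean_sum\<close> pull out the
      constant phase that comes from \<open>\<alpha>\<close>.\<close>
    have e: "?e J = (\<lambda>x. \<Sum>j\<in>{()}. cis (- (2 * pi * b)) *
        cis (2 * pi * (\<Sum>i\<in>UNIV. w $ i * of_int (x $ i))))"
    proof
      fix x :: "int ^ 'n"
      have "(\<Sum>k\<in>UNIV. (real (J k) - real p) * (L *v int_vec x - \<alpha>) $ k) =
          (\<Sum>k\<in>UNIV. of_int (q k) * (L *v int_vec x) $ k) - b"
        by (simp add: q_def b_def algebra_simps sum_subtractf sum.distrib)
      also have "(\<Sum>k\<in>UNIV. of_int (q k) * (L *v int_vec x) $ k) =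
          (\<Sum>i\<in>UNIV. w $ i * of_int (x $ i))"
        unfolding matrix_vector_int_vec w_def sum_distrib_left
        by (subst sum.swap) (simp add: sum_distrib_left sum_distrib_right mult_ac)
      finally show "?e J x = (\<Sum>j\<in>{()}. cis (- (2 * pi * b)) *
        cis (2 * pi * (\<Sum>i\<in>UNIV. w $ i * of_int (x $ i))))"
        by (simp add: cis_mult right_diff_distrib)
    qed
    have "(\<lambda>N. cis (- (2 * pi * b)) *
        cube_mean (\<lambda>x. cis (2 * pi * (\<Sum>i\<in>UNIV. w $ i * of_int (x $ i)))) N) \<longlonglongrightarrow>
          cis (- (2 * pi * b)) * 0"
      by (intro tendsto_intros cube_mean_character_tendsto_0[OF i])
    then show ?thesis
      using False unfolding e cube_mean_sum by simp
  qed
  have fin: "finite ?S" by (simp add: finite_PiE)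
  have "(\<lambda>N. \<Sum>J\<in>?S. ?c J * cube_mean (?e J) N) \<longlonglongrightarrow>
      (\<Sum>J\<in>?S. ?c J * (if J = (\<lambda>_. p) then 1 else 0))"
    by (intro tendsto_intros lim)
  also have "(\<Sum>J\<in>?S. ?c J * (if J = (\<lambda>_. p) then 1 else 0)) = ?c (\<lambda>_. p)"
    using fin by (simp add: if_distrib[of "(*) _"] sum.delta' PiE_iff cong: if_cong)
  finally show ?thesis
    unfolding cos_prod_expansion cube_mean_sum by (simp del: of_real_prod)
qed

text \<open>The squared cosine of \<pi> u depends only on the distance from u to the nearest integer
  and decreases in it on [0, 1/2].\<close>

lemma cos_pi_square_le:
  fixes u \<epsilon> :: real
  assumes "\<And>z::int. \<epsilon> \<le> \<bar>u - of_int z\<bar>" "0 < \<epsilon>"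
  shows "(cos (pi * u))\<^sup>2 \<le> (cos (pi * \<epsilon>))\<^sup>2"
proof -
  define t where "t = u - of_int (round u)"
  have t: "\<epsilon> \<le> \<bar>t\<bar>" "\<bar>t\<bar> \<le> 1 / 2"
    using assms(1)[of "round u"] of_int_round_abs_le[of u] by (auto simp: t_def abs_minus_commute)
  have "sin (pi * of_int (round u)) = 0" by (simp add: mult.commute)
  moreover have "(cos (pi * of_int (round u)))\<^sup>2 = 1"
    using sin_cos_squared_add[of "pi * of_int (round u)"] calculation by simp
  moreover have "pi * u = pi * t + pi * of_int (round u)"
    by (simp add: t_def algebra_simps)
  ultimately have "(cos (pi * u))\<^sup>2 = (cos (pi * t))\<^sup>2"
    by (simp add: cos_add power_mult_distrib)
  also have "\<dots> = (cos (pi * \<bar>t\<bar>))\<^sup>2"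
    by (cases "t \<ge> 0") auto
  also have "\<dots> \<le> (cos (pi * \<epsilon>))\<^sup>2"
  proof (rule power_mono)
    show "cos (pi * \<bar>t\<bar>) \<le> cos (pi * \<epsilon>)"
      using t assms(2) by (intro cos_monotone_0_pi_le) (auto simp: mult_le_cancel_left1)
    show "0 \<le> cos (pi * \<bar>t\<bar>)"
      using t by (intro cos_ge_zero) (auto simp: field_simps intro: order_trans[of _ 0])
  qed
  finally show ?thesis .
qed

lemma dense_orbit:
  fixes L :: "real ^ 'n ^ 'm" and \<alpha> :: "real ^ 'm"
  assumes "nonresonant L" "\<epsilon> > 0"
  obtains x z where "\<And>k. \<bar>(L *v int_vec x + int_vec z - \<alpha>) $ k\<bar> < \<epsilon>"
proof (rule ccontr)
  assume no: "\<not> thesis"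
  \<comment> \<open>The cap 1/4 keeps \<open>pi * \<delta>\<close> strictly between 0 and \<pi>/2,
    so that \<open>\<rho>\<close> lies strictly between 0 and 1.\<close>
  define \<delta> where "\<delta> = min \<epsilon> (1 / 4)"
  have \<delta>: "0 < \<delta>" "\<delta> \<le> 1 / 4" "\<delta> \<le> \<epsilon>" using assms(2) by (auto simp: \<delta>_def)
  define \<rho> where "\<rho> = (cos (pi * \<delta>))\<^sup>2"
  have "0 < sin (pi * \<delta>)"
    using \<delta> by (intro sin_gt_zero) (auto simp: mult_less_cancel_left2 not_le)
  then have "\<rho> < 1"
    using sin_cos_squared_add[of "pi * \<delta>"] unfolding \<rho>_def
    by (smt (verit) zero_less_power)
  have "cos (pi * \<delta>) > 0"
    using \<delta> by (intro cos_gt_zero) (auto simp: field_simps)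
  then have "\<rho> > 0" by (simp add: \<rho>_def)
  \<comment> \<open>The coordinate \<open>k\<close> may depend on \<open>x\<close>. If every
    coordinate were within \<open>\<delta>\<close> of an integer, the negatives of these integers
    would form the excluded lattice vector.\<close>
  have far: "\<exists>k. \<forall>z::int. \<delta> \<le> \<bar>(L *v int_vec x - \<alpha>) $ k - of_int z\<bar>" for x
  proof (rule ccontr)
    assume "\<not> ?thesis"
    then obtain z :: "'m \<Rightarrow> int" where z: "\<And>k. \<bar>(L *v int_vec x - \<alpha>) $ k - of_int (z k)\<bar> < \<delta>"
      by (auto simp: not_le) metis
    have "\<bar>(L *v int_vec x + int_vec (\<chi> k. - z k) - \<alpha>) $ k\<bar> < \<epsilon>" for k
      using z[of k] \<delta>(3) by (simp add: int_vec_def algebra_simps)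
    with that no show False by blast
  qed
  have bd: "norm (complex_of_real (\<Prod>k\<in>UNIV. cos (pi * (L *v int_vec x - \<alpha>) $ k) ^ (2 * p))) \<le> \<rho> ^ p"
    for x p
  proof -
    obtain k where k: "\<And>z::int. \<delta> \<le> \<bar>(L *v int_vec x - \<alpha>) $ k - of_int z\<bar>"
      using far by blast
    let ?c = "\<lambda>k. ((cos (pi * (L *v int_vec x - \<alpha>) $ k))\<^sup>2) ^ p"
    have c01: "0 \<le> ?c k" "?c k \<le> 1" for k
      by (simp, rule power_le_one) (simp_all add: abs_square_le_1)
    \<comment> \<open>The far coordinate alone contributes the decay; the other factors are at most
      1.\<close>
    have "(\<Prod>k\<in>UNIV. ?c k) = ?c k * (\<Prod>k\<in>UNIV-{k}. ?c k)"
      by (subst prod.remove[of _ k]) simp_all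
    also have "\<dots> \<le> ?c k * 1"
      by (intro mult_left_mono prod_le_1 conjI c01)
    also have "?c k \<le> \<rho> ^ p"
      unfolding \<rho>_def by (rule power_mono[OF cos_pi_square_le[OF k \<delta>(1)]]) simp
    finally have "(\<Prod>k\<in>UNIV. ?c k) \<le> \<rho> ^ p" by simp
    moreover have "0 \<le> (\<Prod>k\<in>UNIV. ?c k)" by (intro prod_nonneg) auto
    ultimately show ?thesis by (simp add: power_mult norm_of_real del: of_real_prod)
  qed
  have le: "(real (2 * p choose p) / 4 ^ p) ^ CARD('m) \<le> \<rho> ^ p" for p
  proof -
    have ev: "eventually (\<lambda>N. norm (cube_mean (\<lambda>x. complex_of_real
        (\<Prod>k\<in>UNIV. cos (pi * (L *v int_vec x - \<alpha>) $ k) ^ (2 * p))) N) \<le> \<rho> ^ p) sequentially"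
      using eventually_gt_at_top[of 0] by eventually_elim (rule norm_cube_mean_le[OF bd])
    have "norm (complex_of_real ((real (2 * p choose p) / 4 ^ p) ^ CARD('m))) \<le> \<rho> ^ p"
      by (rule tendsto_upperbound[OF tendsto_norm[OF cube_mean_cos_prod_tendsto[OF assms(1), of \<alpha>]]])
        (rule ev, simp)
    then show ?thesis
      by (simp only: norm_of_real)
  qed
  \<comment> \<open>The central binomial coefficient is at least 4^p / (2 p), so the limit of the
    means is at least (1 / (2 p))^m.\<close>
  have ge1: "1 \<le> \<rho> ^ p * (2 * real p) ^ CARD('m)" if "p > 0" for p
  proof -
    have "1 / (2 * real p) \<le> real (2 * p choose p) / 4 ^ p"
      using central_binomial_lower_bound[OF that] that by (simp add: field_simps)
    then have "(1 / (2 * real p)) ^ CARD('m) \<le> (real (2 * p choose p) / 4 ^ p) ^ CARD('m)"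
      by (intro power_mono) auto
    with le[of p] have "(1 / (2 * real p)) ^ CARD('m) \<le> \<rho> ^ p" by linarith
    then show ?thesis using that by (simp add: power_divide field_simps)
  qed
  \<comment> \<open>With this root, \<open>\<rho> ^ p * (2 * real p) ^ CARD('m)\<close> is the m-th
    power of 2 p \<sigma>^p, which tends to 0 and so contradicts \<open>ge1\<close>.\<close>
  define \<sigma> where "\<sigma> = root CARD('m) \<rho>"
  have \<sigma>: "0 < \<sigma>" "\<sigma> < 1" "\<sigma> ^ CARD('m) = \<rho>"
    using \<open>0 < \<rho>\<close> \<open>\<rho> < 1\<close> by (simp_all add: \<sigma>_def)
  have "(\<lambda>p. (2 * (of_nat p / (1 / \<sigma>) ^ p)) ^ CARD('m)) \<longlonglongrightarrow> (2 * 0) ^ CARD('m)"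
    using \<sigma> by (intro tendsto_intros lim_n_over_pown) simp
  moreover have "(2 * (of_nat p / (1 / \<sigma>) ^ p)) ^ CARD('m) = \<rho> ^ p * (2 * real p) ^ CARD('m)" for p
    unfolding \<sigma>(3)[symmetric] power_mult[symmetric] mult.commute[of "CARD('m)"]
    by (simp add: power_mult_distrib power_divide power_mult)
  ultimately have "(\<lambda>p. \<rho> ^ p * (2 * real p) ^ CARD('m)) \<longlonglongrightarrow> 0"
    by (simp only: mult_zero_right zero_power[OF zero_less_card_finite])
  then have "eventually (\<lambda>p. \<rho> ^ p * (2 * real p) ^ CARD('m) < 1) sequentially"
    by (rule order_tendstoD) simp
  then have "eventually (\<lambda>p. False) sequentially"
    using eventually_gt_at_top[of 0]
  proof eventually_elim
    case (elim p)
    with ge1[of p] show ?case by linarith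
  qed
  then show False by simp
qed

subsection \<open>Densities in integer boxes\<close>

lemma bij_betw_vec_lambda_PiE:
  "bij_betw vec_lambda (PiE UNIV S) {x. \<forall>k. x $ k \<in> S k}"
  by (rule bij_betw_byWitness[of _ vec_nth]) (auto simp: PiE_iff vec_lambda_inverse)

lemma card_vec_box: "card {x::'a ^ 'n. \<forall>k. x $ k \<in> S k} = (\<Prod>k\<in>UNIV. card (S k))"
  using bij_betw_same_card[OF bij_betw_vec_lambda_PiE[of S]] by (simp add: card_PiE)

lemma finite_vec_box:
  assumes "\<And>k. finite (S k)"
  shows "finite {x::'a ^ 'n. \<forall>k. x $ k \<in> S k}"
  using bij_betw_finite[OF bij_betw_vec_lambda_PiE[of S]] assms by (simp add: finite_PiE)

lemma int_box_eq: "int_box a l = {x. \<forall>k. x $ k \<in> {a $ k..<a $ k + int (l $ k)}}"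
  by (simp add: int_box_def)

lemma finite_int_box: "finite (int_box a l)"
  unfolding int_box_eq by (rule finite_vec_box) simp

lemma card_int_box: "card (int_box a l) = (\<Prod>k\<in>UNIV. l $ k)"
  unfolding int_box_eq card_vec_box by simp

lemma int_boxes_finite: "P \<in> int_boxes N \<Longrightarrow> finite P"
  by (auto simp: int_boxes_def finite_int_box)

lemma int_boxes_card_pos: "P \<in> int_boxes N \<Longrightarrow> 1 \<le> N \<Longrightarrow> 0 < card P"
  by (auto simp: int_boxes_def card_int_box prod_pos intro!: prod_pos dest: less_le_trans)
     (meson less_eq_Suc_le order_trans)

lemma int_boxes_mono: "M \<le> N \<Longrightarrow> int_boxes N \<subseteq> int_boxes M"
  unfolding int_boxes_def using order_trans by blast

lemma density_in_nonneg: "0 \<le> density_in A P"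
  by (simp add: density_in_def)

lemma density_in_mono: "finite P \<Longrightarrow> A \<subseteq> B \<Longrightarrow> density_in A P \<le> density_in B P"
  unfolding density_in_def by (intro divide_right_mono) (auto intro!: card_mono)

lemma density_in_le_1: "finite P \<Longrightarrow> density_in A P \<le> 1"
  unfolding density_in_def by (cases "card P = 0") (auto simp: divide_le_eq_1 card_gt_0_iff intro!: card_mono)

lemma density_in_UNIV: "card P > 0 \<Longrightarrow> density_in UNIV P = 1"
  by (simp add: density_in_def)

lemma density_in_UN:
  assumes "finite P" "finite I" "disjoint_family_on A I"
  shows "density_in (\<Union>i\<in>I. A i) P = (\<Sum>i\<in>I. density_in (A i) P)"
proof -
  have "card ((\<Union>i\<in>I. A i) \<inter> P) = card (\<Union>i\<in>I. A i \<inter> P)"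
    by (rule arg_cong[of _ _ card]) blast
  also have "\<dots> = (\<Sum>i\<in>I. card (A i \<inter> P))"
    using assms by (intro card_UN_disjoint) (auto simp: disjoint_family_on_def)
  finally show ?thesis by (simp add: density_in_def sum_divide_distrib)
qed

lemma card_int_box_shift_diff:
  fixes a y :: "int ^ 'n" and l :: "nat ^ 'n"
  assumes "\<And>k. N \<le> l $ k" "1 \<le> N"
  shows "real (card (int_box (a - y) l - int_box a l)) \<le>
    (\<Sum>k\<in>UNIV. \<bar>y $ k\<bar>) / N * real (card (int_box a l))"
proof -
  \<comment> \<open>A point lost by the shift lies, for some \<open>k\<close>, in a slab \<open>?B k\<close> of thickness \<open>\<bar>y $ k\<bar>\<close>.\<close>
  let ?e = "\<lambda>k. (if 0 \<le> y $ k then a $ k - y $ k else a $ k + int (l $ k))"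
  let ?B = "\<lambda>k. int_box (\<chi> j. if j = k then ?e k else (a - y) $ j)
      (\<chi> j. if j = k then nat \<bar>y $ k\<bar> else l $ j)"
  have "int_box (a - y) l - int_box a l \<subseteq> (\<Union>k\<in>UNIV. ?B k)"
  proof
    fix x assume x: "x \<in> int_box (a - y) l - int_box a l"
    then obtain k where k: "\<not> (a $ k \<le> x $ k \<and> x $ k < a $ k + int (l $ k))"
      by (auto simp: int_box_def)
    have "x \<in> ?B k"
      unfolding int_box_def
    proof (rule CollectI, rule allI)
      fix j
      show "(\<chi> j. if j = k then ?e k else (a - y) $ j) $ j \<le> x $ j \<and> x $ j <
          (\<chi> j. if j = k then ?e k else (a - y) $ j) $ j +
          int ((\<chi> j. if j = k then nat \<bar>y $ k\<bar> else l $ j) $ j)"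
        using x k by (cases "j = k") (auto simp: int_box_def dest!: spec[of _ j])
    qed
    then show "x \<in> (\<Union>k\<in>UNIV. ?B k)" by blast
  qed
  then have "card (int_box (a - y) l - int_box a l) \<le> card (\<Union>k\<in>UNIV. ?B k)"
    by (intro card_mono) (auto simp: finite_int_box)
  also have "\<dots> \<le> (\<Sum>k\<in>UNIV. card (?B k))"
    by (rule card_UN_le) simp
  finally have "real (card (int_box (a - y) l - int_box a l)) \<le> (\<Sum>k\<in>UNIV. real (card (?B k)))"
    by (simp add: of_nat_le_iff[symmetric, where 'a = real] del: of_nat_le_iff)
  also have "\<dots> \<le> (\<Sum>k\<in>UNIV. real_of_int \<bar>y $ k\<bar> / N * real (card (int_box a l)))"
  proof (rule sum_mono)
    fix k
    have "real (card (?B k)) = real_of_int \<bar>y $ k\<bar> * (\<Prod>j\<in>UNIV - {k}. real (l $ j))"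
      unfolding card_int_box by (subst prod.remove[of _ k]) (auto intro!: prod.cong)
    \<comment> \<open>The side that the slab replaces has length at least \<open>N\<close>, so the
      slab has at most the fraction \<open>\<bar>y $ k\<bar> / N\<close> of the points of the
      box.\<close>
    also have "\<dots> \<le> real_of_int \<bar>y $ k\<bar> / N * (real (l $ k) * (\<Prod>j\<in>UNIV - {k}. real (l $ j)))"
    proof -
      have "1 \<le> real (l $ k) / N" using assms(1)[of k] assms(2) by simp
      then have "real_of_int \<bar>y $ k\<bar> * (\<Prod>j\<in>UNIV - {k}. real (l $ j)) * 1 \<le>
          real_of_int \<bar>y $ k\<bar> * (\<Prod>j\<in>UNIV - {k}. real (l $ j)) * (real (l $ k) / N)"
        by (intro mult_left_mono) (auto intro!: mult_nonneg_nonneg prod_nonneg)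
      then show ?thesis by (simp add: mult_ac)
    qed
    also have "real (l $ k) * (\<Prod>j\<in>UNIV - {k}. real (l $ j)) = real (card (int_box a l))"
      unfolding card_int_box of_nat_prod by (subst (2) prod.remove[of _ k]) auto
    finally show "real (card (?B k)) \<le> real_of_int \<bar>y $ k\<bar> / N * real (card (int_box a l))" .
  qed
  also have "\<dots> = (\<Sum>k\<in>UNIV. \<bar>y $ k\<bar>) / N * real (card (int_box a l))"
    by (simp add: sum_distrib_right sum_divide_distrib)
  finally show ?thesis .
qed

text \<open>Translation by \<open>y\<close> injects \<open>A \<inter> P\<close> into
  \<open>B\<close> intersected with the translated box, and the points that fall outside
  \<open>P\<close> are counted by \<open>card_int_box_shift_diff\<close>.\<close>

lemma density_in_shift:
  fixes y :: "int ^ 'n"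
  assumes "P \<in> int_boxes N" "1 \<le> N" "(+) y ` A \<subseteq> B"
  shows "density_in A P \<le> density_in B P + (\<Sum>k\<in>UNIV. \<bar>y $ k\<bar>) / N"
proof -
  obtain a l where P: "P = int_box a l" and l: "\<And>k. N \<le> l $ k"
    using assms(1) by (auto simp: int_boxes_def)
  have img: "(+) y ` P = int_box (a + y) l"
  proof
    show "int_box (a + y) l \<subseteq> (+) y ` P"
    proof
      fix x assume "x \<in> int_box (a + y) l"
      then have "x - y \<in> P" unfolding P int_box_def by (auto simp: algebra_simps)
      then show "x \<in> (+) y ` P" by (force intro: image_eqI[of _ _ "x - y"])
    qed
  qed (auto simp: P int_box_def algebra_simps)
  have "card (A \<inter> P) = card ((+) y ` (A \<inter> P))"
    by (simp add: card_image)
  \<comment> \<open>The translated box is written as \<open>a - (- y)\<close> to fit the sign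
    convention of \<open>card_int_box_shift_diff\<close>.\<close>
  also have "\<dots> \<le> card (B \<inter> P \<union> (int_box (a - (- y)) l - int_box a l))"
    using assms(3) img by (intro card_mono) (auto simp: finite_int_box P)
  also have "\<dots> \<le> card (B \<inter> P) + card (int_box (a - (- y)) l - int_box a l)"
    by (rule card_Un_le)
  finally have "real (card (A \<inter> P)) \<le>
      real (card (B \<inter> P)) + (\<Sum>k\<in>UNIV. \<bar>(- y) $ k\<bar>) / N * real (card P)"
    using card_int_box_shift_diff[OF l assms(2), of a "- y"] unfolding P by linarith
  then show ?thesis
    using int_boxes_card_pos[OF assms(1,2)] by (simp add: density_in_def field_simps)
qed

text \<open>Every \<open>lo M\<close> is at most every \<open>hi N\<close>. Since some
  \<open>lo N\<close> is at least \<mu> - \<epsilon> and some \<open>hi N\<close> at most \<mu> +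
  \<epsilon>, this forces \<open>lo N \<le> \<mu> \<le> hi N\<close> for all \<open>N\<close>, with
  \<mu> as the common extremum.\<close>

lemma frequency_eqI:
  fixes A :: "(int ^ 'n) set"
  assumes "\<And>\<epsilon>. \<epsilon> > 0 \<Longrightarrow> \<exists>N\<ge>1. \<forall>P\<in>int_boxes N. \<bar>density_in A P - \<mu>\<bar> \<le> \<epsilon>"
  shows "lower_frequency A = \<mu>" "upper_frequency A = \<mu>"
proof -
  define lo where "lo N = (INF P\<in>int_boxes N. density_in A P)" for N
  define hi where "hi N = (SUP P\<in>int_boxes N. density_in A P)" for N
  have mem: "int_box 0 (\<chi> _. N) \<in> (int_boxes N :: (int ^ 'n) set set)" for N
    unfolding int_boxes_def by (rule CollectI, rule exI, rule exI, rule conjI, rule refl) simp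
  then have ne: "int_boxes N \<noteq> ({} :: (int ^ 'n) set set)" for N by blast
  have bb: "bdd_below (density_in A ` int_boxes N)" for N
    by (rule bdd_belowI[of _ 0]) (auto simp: density_in_nonneg)
  have ba: "bdd_above (density_in A ` int_boxes N)" for N
    by (rule bdd_aboveI[of _ 1]) (auto intro: density_in_le_1 int_boxes_finite)
  have lohi: "lo M \<le> hi N" for M N
  proof -
    \<comment> \<open>A box belonging to both families; its density separates \<open>lo M\<close>
      from \<open>hi N\<close>.\<close>
    let ?P = "int_box 0 (\<chi> _. max M N) :: (int ^ 'n) set"
    have "?P \<in> int_boxes M" "?P \<in> int_boxes N"
      using mem[of "max M N"] int_boxes_mono by (meson max.cobounded1 max.cobounded2 subsetD)+
    then show ?thesis unfolding lo_def hi_def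
      by (intro cINF_lower2[OF bb _ cSUP_upper[OF _ ba]])
  qed
  have ex: "\<exists>N\<ge>1. \<mu> - \<epsilon> \<le> lo N \<and> hi N \<le> \<mu> + \<epsilon>" if e: "\<epsilon> > 0" for \<epsilon>
  proof -
    obtain N where N: "N \<ge> 1" "\<And>P. P \<in> int_boxes N \<Longrightarrow> \<bar>density_in A P - \<mu>\<bar> \<le> \<epsilon>"
      using assms[OF e] by blast
    have "\<mu> - \<epsilon> \<le> density_in A P" "density_in A P \<le> \<mu> + \<epsilon>" if "P \<in> int_boxes N" for P
      using N(2)[OF that] by linarith+
    then have "\<mu> - \<epsilon> \<le> lo N" "hi N \<le> \<mu> + \<epsilon>"
      unfolding lo_def hi_def by (auto intro!: cINF_greatest cSUP_least ne)
    with N(1) show ?thesis by blast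
  qed
  have "lo N \<le> \<mu>" for N
    by (rule field_le_epsilon) (use ex lohi order_trans in blast)
  moreover have "\<mu> \<le> hi N" for N
  proof (rule field_le_epsilon)
    fix e :: real assume "e > 0"
    then obtain M where "\<mu> - e \<le> lo M" using ex by blast
    with lohi[of M N] show "\<mu> \<le> hi N + e" by linarith
  qed
  ultimately have lo: "\<And>N. lo N \<le> \<mu>" and hi: "\<And>N. \<mu> \<le> hi N" by blast+
  have bdl: "bdd_above (lo ` {1..})" and bdh: "bdd_below (hi ` {1..})"
    using lo hi by (auto intro: bdd_aboveI[of _ \<mu>] bdd_belowI[of _ \<mu>])
  have "(SUP N\<in>{1..}. lo N) = \<mu>"
  proof (rule antisym)
    show "\<mu> \<le> (SUP N\<in>{1..}. lo N)"
    proof (rule field_le_epsilon)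
      fix e :: real assume "e > 0"
      then obtain N where "N \<ge> 1" "\<mu> - e \<le> lo N" using ex by blast
      moreover from this have "lo N \<le> (SUP N\<in>{1..}. lo N)"
        by (intro cSUP_upper bdl) auto
      ultimately show "\<mu> \<le> (SUP N\<in>{1..}. lo N) + e" by linarith
    qed
  qed (auto intro!: cSUP_least lo)
  moreover have "(INF N\<in>{1..}. hi N) = \<mu>"
  proof (rule antisym)
    show "(INF N\<in>{1..}. hi N) \<le> \<mu>"
    proof (rule field_le_epsilon)
      fix e :: real assume "e > 0"
      then obtain N where "N \<ge> 1" "hi N \<le> \<mu> + e" using ex by blast
      moreover from this have "(INF N\<in>{1..}. hi N) \<le> hi N"
        by (intro cINF_lower bdh) auto
      ultimately show "(INF N\<in>{1..}. hi N) \<le> \<mu> + e" by linarith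
    qed
  qed (auto intro!: cINF_greatest hi)
  ultimately show "lower_frequency A = \<mu>" "upper_frequency A = \<mu>"
    by (simp_all add: lower_frequency_def upper_frequency_def lo_def hi_def)
qed

subsection \<open>Cells and grid cubes\<close>

lemma int_vec_nth [simp]: "int_vec z $ k = of_int (z $ k)"
  by (simp add: int_vec_def)

lemma int_vec_add: "int_vec (y + z) = int_vec y + int_vec z"
  by (simp add: vec_eq_iff)

lemma int_vec_minus: "int_vec (- z) = - int_vec z"
  by (simp add: vec_eq_iff)

lemma mem_plus_range_int_vec_iff: "u \<in> E + range int_vec \<longleftrightarrow> (\<exists>z. u + int_vec z \<in> E)"
proof
  assume "u \<in> E + range int_vec"
  then obtain e z where "e \<in> E" "u = e + int_vec z" by (auto simp: set_plus_def)
  then have "u + int_vec (- z) \<in> E" by (simp add: int_vec_minus)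
  then show "\<exists>z. u + int_vec z \<in> E" ..
next
  assume "\<exists>z. u + int_vec z \<in> E"
  then obtain z where "u + int_vec z \<in> E" ..
  then have "(u + int_vec z) + int_vec (- z) \<in> E + range int_vec" by (intro set_plus_intro) auto
  then show "u \<in> E + range int_vec" by (simp add: int_vec_minus)
qed

lemma plus_range_int_vec_periodic:
  "u + int_vec z \<in> E + range int_vec \<longleftrightarrow> u \<in> E + range int_vec"
proof -
  have "(\<exists>y. u + int_vec z + int_vec y \<in> E) \<longleftrightarrow> (\<exists>y. u + int_vec y \<in> E)"
    by (metis add.assoc int_vec_add add_diff_cancel_left' diff_add_cancel add.commute)
  then show ?thesis by (simp only: mem_plus_range_int_vec_iff)
qed

lemma Q_set_iff: "x \<in> Q_set E L \<longleftrightarrow> (\<exists>z. L *v int_vec x + int_vec z \<in> E)"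
  by (simp add: Q_set_def mem_plus_range_int_vec_iff)

lemma Q_set_UN: "Q_set (\<Union>i\<in>I. E i) L = (\<Union>i\<in>I. Q_set (E i) L)"
  unfolding set_eq_iff UN_iff Q_set_iff by blast

lemma mem_image_translation_iff: "x \<in> (+) (a::'a::group_add) ` S \<longleftrightarrow> - a + x \<in> S"
proof
  assume "- a + x \<in> S"
  then have "a + (- a + x) \<in> (+) a ` S" by (rule imageI)
  then show "x \<in> (+) a ` S" by (simp add: add.assoc[symmetric])
qed (auto simp: add.assoc[symmetric])

lemma partition_iff_ex1:
  "disjoint_family T \<and> (\<Union>z. T z) = UNIV \<longleftrightarrow> (\<forall>u. \<exists>!z. u \<in> T z)" (is "?l \<longleftrightarrow> ?r")
proof
  assume l: ?l
  show ?r
  proof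
    fix u
    from l obtain z where "u \<in> T z" by blast
    moreover have "y = z" if "u \<in> T y" "u \<in> T z" for y z
      using l that unfolding disjoint_family_on_def by blast
    ultimately show "\<exists>!z. u \<in> T z" by blast
  qed
next
  assume r: ?r
  then have "T y \<inter> T z = {}" if "y \<noteq> z" for y z using that by blast
  moreover have "u \<in> (\<Union>z. T z)" for u using r by blast
  ultimately show ?l unfolding disjoint_family_on_def by blast
qed

text \<open>A cell is a set of representatives of the classes modulo the integer lattice. The sign
  change from translating \<open>V\<close> to translating \<open>u\<close> is absorbed by the
  bijection \<open>z\<close> to \<open>- z\<close>.\<close>

lemma cell_iff: "cell V \<longleftrightarrow> (\<forall>u. \<exists>!z. u + int_vec z \<in> V)"
proof -
  have neg: "(\<exists>!z::int ^ 'a. P (- z)) \<longleftrightarrow> (\<exists>!z. P z)" for P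
    by (metis minus_minus)
  have eq: "u \<in> (+) (int_vec z) ` V \<longleftrightarrow> u + int_vec (- z) \<in> V" for u z
    unfolding mem_image_translation_iff int_vec_minus by (simp only: add.commute)
  have "cell V \<longleftrightarrow> (\<forall>u. \<exists>!z. u \<in> (+) (int_vec z) ` V)"
    unfolding cell_def by (rule partition_iff_ex1)
  also have "\<dots> \<longleftrightarrow> (\<forall>u. \<exists>!z. u + int_vec z \<in> V)"
    unfolding eq using neg[of "\<lambda>z. _ + int_vec z \<in> V"] by simp
  finally show ?thesis .
qed

lemma emeasure_lebesgue_translation:
  "emeasure lebesgue ((+) a ` S) = emeasure lebesgue (S :: 'a::euclidean_space set)"
  using emeasure_lebesgue_affine[of 1 a S] by (simp add: ac_simps cong: image_cong_simp)

text \<open>Cut \<open>V \<inter> B\<close> by the translates of \<open>W\<close> and move each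
  piece back by its lattice vector. Periodicity keeps the piece inside \<open>B\<close>, and the
  moved pieces are \<open>W \<inter> B\<close> cut by the translates of \<open>V\<close>.\<close>

lemma emeasure_cell_Int_periodic:
  fixes B V W :: "(real ^ 'm) set"
  assumes V: "V \<in> sets lebesgue" "cell V" and W: "W \<in> sets lebesgue" "cell W"
    and B: "B \<in> sets lebesgue" "\<And>u z. u + int_vec z \<in> B \<longleftrightarrow> u \<in> B"
  shows "emeasure lebesgue (V \<inter> B) = emeasure lebesgue (W \<inter> B)"
proof -
  have tr: "(+) (int_vec z) ` V \<in> sets lebesgue" if "V \<in> sets lebesgue" for V :: "(real ^ 'm) set" and z
    using that by (rule lebesgue_sets_translation)
  have VU: "(\<Union>z. V \<inter> B \<inter> (+) (int_vec z) ` W) = V \<inter> B"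
    using W(2) unfolding cell_def by blast
  have WU: "(\<Union>z. W \<inter> B \<inter> (+) (int_vec z) ` V) = W \<inter> B"
    using V(2) unfolding cell_def by blast
  have Vd: "disjoint_family (\<lambda>z. V \<inter> B \<inter> (+) (int_vec z) ` W)"
    using W(2) unfolding cell_def disjoint_family_on_def by blast
  have Wd: "disjoint_family (\<lambda>z. W \<inter> B \<inter> (+) (int_vec z) ` V)"
    using V(2) unfolding cell_def disjoint_family_on_def by blast
  have "emeasure lebesgue (V \<inter> B) =
      (\<integral>\<^sup>+ z. emeasure lebesgue (V \<inter> B \<inter> (+) (int_vec z) ` W) \<partial>count_space UNIV)"
    using emeasure_UN_countable[OF _ _ Vd, of lebesgue] V W B tr unfolding VU by simp
  also have "\<dots> = (\<integral>\<^sup>+ z. emeasure lebesgue (W \<inter> B \<inter> (+) (int_vec (- z)) ` V) \<partial>count_space UNIV)"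
  proof (rule nn_integral_cong)
    fix z :: "int ^ 'm"
    have Bm: "u - int_vec z \<in> B \<longleftrightarrow> u \<in> B" for u z
      using B(2)[of u "- z"] by (simp add: int_vec_minus)
    have "V \<inter> B \<inter> (+) (int_vec z) ` W = (+) (int_vec z) ` (W \<inter> B \<inter> (+) (int_vec (- z)) ` V)"
      by (auto simp: set_eq_iff mem_image_translation_iff int_vec_minus Bm)
    then show "emeasure lebesgue (V \<inter> B \<inter> (+) (int_vec z) ` W) =
        emeasure lebesgue (W \<inter> B \<inter> (+) (int_vec (- z)) ` V)"
      by (simp add: emeasure_lebesgue_translation)
  qed
  also have "\<dots> = (\<integral>\<^sup>+ z. emeasure lebesgue (W \<inter> B \<inter> (+) (int_vec z) ` V) \<partial>count_space UNIV)"
    by (rule nn_integral_bij_count_space) (rule bij_uminus)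
  also have "\<dots> = emeasure lebesgue (W \<inter> B)"
    using emeasure_UN_countable[OF _ _ Wd, of lebesgue] V W B tr unfolding WU by simp
  finally show ?thesis .
qed

section \<open>Half-open cubes and the grid of side 1 / K in the unit cube\<close>

definition cube :: "real ^ 'm \<Rightarrow> real \<Rightarrow> (real ^ 'm) set"
  where "cube c s = {u. \<forall>k. c $ k \<le> u $ k \<and> u $ k < c $ k + s}"

lemma cube_lmeasurable [simp, intro]: "cube c s \<in> lmeasurable"
proof (rule bounded_set_imp_lmeasurable)
  have "cube c s \<subseteq> cbox c (c + (\<chi> k. s))"
    by (auto simp: cube_def mem_box_cart less_imp_le)
  then show "bounded (cube c s)"
    using bounded_cbox bounded_subset by blast
  have "cube c s = (\<Inter>k. {u. c $ k \<le> u $ k} \<inter> {u. u $ k < c $ k + s})"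
    by (auto simp: cube_def)
  also have "\<dots> \<in> sets borel"
    by (intro sets.finite_INT sets.Int borel_closed borel_open closed_Collect_le open_Collect_less
        continuous_intros) auto
  finally have "cube c s \<in> sets borel" .
  then have "cube c s \<in> sets lborel" by simp
  then show "cube c s \<in> sets lebesgue" by (rule sets_completionI_sets)
qed

lemma measure_cube:
  fixes c :: "real ^ 'm"
  assumes "0 \<le> s"
  shows "measure lebesgue (cube c s) = s ^ CARD('m)"
proof -
  let ?d = "c + (\<chi> k. s)"
  have "cbox c ?d \<noteq> {}" using assms by (simp add: interval_ne_empty_cart)
  then have cb: "measure lebesgue (cbox c ?d) = s ^ CARD('m)"
    by (simp add: content_cbox_cart)
  have "measure lborel (box c ?d) = measure lborel (cbox c ?d)"
    by (simp add: measure_lborel_cbox_eq measure_lborel_box_eq)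
  then have b: "measure lebesgue (box c ?d) = s ^ CARD('m)"
    using cb by simp
  have "box c ?d \<subseteq> cube c s" "cube c s \<subseteq> cbox c ?d"
    by (auto simp: cube_def mem_box_cart less_imp_le)
  note sub = this
  have "measure lebesgue (box c ?d) \<le> measure lebesgue (cube c s)"
    by (rule measure_mono_fmeasurable[OF sub(1)]) (simp_all add: fmeasurableD)
  moreover have "measure lebesgue (cube c s) \<le> measure lebesgue (cbox c ?d)"
    by (rule measure_mono_fmeasurable[OF sub(2)]) (simp_all add: fmeasurableD)
  ultimately show ?thesis using b cb by linarith
qed

lemma connected_cube: "connected (cube c s)"
proof (rule is_interval_connected)
  have "l \<le> x \<and> x < h" if "l \<le> a \<and> a < h" "l \<le> b \<and> b < h" "a \<le> x \<and> x \<le> b \<or> b \<le> x \<and> x \<le> a"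
    for l h a b x :: real
    using that by linarith
  then show "is_interval (cube c s)"
    unfolding is_interval_cart cube_def mem_Collect_eq by blast
qed

text \<open>Because the cube is half-open, the only lattice vector that brings \<open>u\<close> into
  it is minus the coordinatewise floor.\<close>

lemma cell_unit_cube: "cell (cube 0 1)"
proof -
  have "\<exists>!z. u + int_vec z \<in> cube 0 1" for u :: "real ^ 'm"
  proof
    show "u + int_vec (\<chi> k. - \<lfloor>u $ k\<rfloor>) \<in> cube 0 1"
      by (auto simp: cube_def) linarith+
    fix z assume "u + int_vec z \<in> cube 0 1"
    then have "z $ k = - \<lfloor>u $ k\<rfloor>" for k
      by (auto simp: cube_def dest!: spec[of _ k]) linarith
    then show "z = (\<chi> k. - \<lfloor>u $ k\<rfloor>)" by (simp add: vec_eq_iff)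
  qed
  then show ?thesis unfolding cell_iff ..
qed

definition grid :: "nat \<Rightarrow> (int ^ 'm) set"
  where "grid K = int_box 0 (\<chi> _. K)"

definition grid_cube :: "nat \<Rightarrow> int ^ 'm \<Rightarrow> (real ^ 'm) set"
  where "grid_cube K i = cube ((1 / K) *\<^sub>R int_vec i) (1 / K)"

text \<open>The index of the grid cube containing \<open>u\<close> is read off as a floor, from
  which both the tiling and the disjointness follow.\<close>

lemma grid_cube_iff:
  assumes "K > 0"
  shows "u \<in> grid_cube K i \<longleftrightarrow> (\<forall>k. i $ k = \<lfloor>K * u $ k\<rfloor>)"
proof -
  have "real_of_int j / K \<le> v \<and> v < real_of_int j / K + 1 / K \<longleftrightarrow> j = \<lfloor>K * v\<rfloor>"
    for j and v :: real
    using assms by (auto simp: eq_commute[of _ "\<lfloor>_\<rfloor>"] floor_eq_iff field_simps)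
  then show ?thesis by (simp add: grid_cube_def cube_def)
qed

lemma UN_grid_cube:
  assumes "K > 0"
  shows "(\<Union>i\<in>grid K. grid_cube K i) = (cube 0 1 :: (real ^ 'm) set)"
proof -
  have fl: "0 \<le> \<lfloor>K * v\<rfloor> \<and> \<lfloor>K * v\<rfloor> < int K \<longleftrightarrow> 0 \<le> v \<and> v < 1" for v :: real
    using assms by (auto simp: floor_less_iff zero_le_mult_iff)
  have "(\<exists>i\<in>grid K. u \<in> grid_cube K i) \<longleftrightarrow> (\<chi> k. \<lfloor>K * u $ k\<rfloor>) \<in> grid K" for u :: "real ^ 'm"
  proof -
    have "u \<in> grid_cube K i \<longleftrightarrow> i = (\<chi> k. \<lfloor>K * u $ k\<rfloor>)" for i
      using assms by (simp add: grid_cube_iff vec_eq_iff)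
    then show ?thesis by simp
  qed
  moreover have "(\<chi> k. \<lfloor>K * u $ k\<rfloor>) \<in> grid K \<longleftrightarrow> u \<in> cube 0 1" for u :: "real ^ 'm"
    by (simp add: grid_def int_box_def cube_def fl del: zero_le_floor)
  ultimately show ?thesis by blast
qed

lemma disjoint_grid_cubes: "K > 0 \<Longrightarrow> i \<noteq> j \<Longrightarrow> grid_cube K i \<inter> grid_cube K j = {}"
  by (auto simp: grid_cube_iff vec_eq_iff)

lemma grid_cube_subset_unit: "K > 0 \<Longrightarrow> i \<in> grid K \<Longrightarrow> grid_cube K i \<subseteq> cube 0 1"
  using UN_grid_cube by blast

lemma measure_UN_grid_cubes:
  assumes "K > 0" "finite I"
  shows "measure lebesgue (\<Union>i\<in>I. grid_cube K i :: (real ^ 'm) set) = card I / K ^ CARD('m)"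
proof -
  have "measure lebesgue (\<Union>i\<in>I. grid_cube K i :: (real ^ 'm) set) =
      (\<Sum>i\<in>I. measure lebesgue (grid_cube K i :: (real ^ 'm) set))"
    using assms
    by (intro measure_negligible_finite_Union_image)
      (simp_all add: pairwise_def disjoint_grid_cubes, simp add: grid_cube_def)
  then show ?thesis
    by (simp add: grid_cube_def measure_cube power_divide)
qed

text \<open>A common point \<open>x\<close> would have one lattice translate of
  \<open>L *v int_vec x\<close> in \<open>E\<close> and one in \<open>F\<close>. Both lie in
  \<open>V\<close>, so they coincide, against the disjointness of \<open>E\<close> and
  \<open>F\<close>.\<close>

lemma disjoint_Q_set_subset_cell:
  assumes "cell V" "E \<subseteq> V" "F \<subseteq> V" "E \<inter> F = {}"
  shows "Q_set E L \<inter> Q_set F L = {}"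
  using assms unfolding cell_iff by (auto simp: Q_set_iff) blast

lemma dist_grid_cube_le:
  fixes u v :: "real ^ 'm"
  assumes "u \<in> grid_cube K i" "v \<in> grid_cube K i"
  shows "dist u v \<le> CARD('m) / K"
proof -
  have "dist u v \<le> (\<Sum>k\<in>UNIV. \<bar>(u - v) $ k\<bar>)"
    unfolding dist_norm by (rule norm_le_l1_cart)
  also have "\<dots> \<le> of_nat (card (UNIV :: 'm set)) * (1 / K)"
  proof (rule sum_bounded_above)
    fix k
    show "\<bar>(u - v) $ k\<bar> \<le> 1 / K"
      using assms[unfolded grid_cube_def cube_def, simplified, rule_format, of k]
      by (auto dest!: spec[of _ k])
  qed
  finally show ?thesis by simp
qed

subsection \<open>Equidistribution over grid cubes\<close>

lemma finite_grid [simp]: "finite (grid K)"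
  by (simp add: grid_def finite_int_box)

lemma card_grid: "card (grid K :: (int ^ 'm) set) = K ^ CARD('m)"
  by (simp add: grid_def card_int_box)

lemma cube_density_le_eventually:
  fixes L :: "real ^ 'n ^ 'm"
  assumes "nonresonant L" "s < s'" "\<epsilon> > 0"
  shows "\<forall>\<^sub>F N in sequentially. \<forall>P\<in>int_boxes N.
    density_in (Q_set (cube c s) L) P \<le> density_in (Q_set (cube c' s') L) P + \<epsilon>"
proof -
  \<comment> \<open>Moving the small cube by c' + \<delta> - c centres it in the large one with
    margin \<open>\<delta>\<close> on every side, so a lattice orbit point within
    \<open>\<delta>\<close> of this vector still moves it inside.\<close>
  define \<delta> where "\<delta> = (s' - s) / 2"
  have "\<delta> > 0" using assms(2) by (simp add: \<delta>_def)
  then obtain y z where yz: "\<And>k. \<bar>(L *v int_vec y + int_vec z - (c' + (\<chi> k. \<delta>) - c)) $ k\<bar> < \<delta>"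
    using dense_orbit[OF assms(1)] by blast
  have shift: "(+) y ` Q_set (cube c s) L \<subseteq> Q_set (cube c' s') L"
  proof clarify
    fix x assume "x \<in> Q_set (cube c s) L"
    then obtain w where w: "L *v int_vec x + int_vec w \<in> cube c s" by (auto simp: Q_set_iff)
    have "L *v int_vec (y + x) + int_vec (w + z) =
        (L *v int_vec x + int_vec w) + (L *v int_vec y + int_vec z)"
      by (simp add: int_vec_add matrix_vector_right_distrib)
    also have "\<dots> \<in> cube c' s'"
      unfolding cube_def
    proof (intro CollectI allI)
      fix k
      have "c $ k \<le> (L *v int_vec x + int_vec w) $ k \<and> (L *v int_vec x + int_vec w) $ k < c $ k + s"
        using w by (simp add: cube_def)
      moreover have "\<bar>(L *v int_vec y + int_vec z) $ k - (c' $ k + \<delta> - c $ k)\<bar> < \<delta>"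
        using yz[of k] by simp
      moreover have "s' = s + 2 * \<delta>" by (simp add: \<delta>_def field_simps)
      ultimately show "c' $ k \<le> (L *v int_vec x + int_vec w + (L *v int_vec y + int_vec z)) $ k \<and>
          (L *v int_vec x + int_vec w + (L *v int_vec y + int_vec z)) $ k < c' $ k + s'"
        unfolding vector_add_component[of "L *v int_vec x + int_vec w"] by linarith
    qed
    finally show "y + x \<in> Q_set (cube c' s') L" by (auto simp: Q_set_iff)
  qed
  have "(\<lambda>N. (\<Sum>k\<in>UNIV. \<bar>y $ k\<bar>) / real N) \<longlonglongrightarrow> 0"
    by (rule lim_const_over_n)
  then have "\<forall>\<^sub>F N in sequentially. (\<Sum>k\<in>UNIV. \<bar>y $ k\<bar>) / real N < \<epsilon>"
    using assms(3) by (rule order_tendstoD)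
  then show ?thesis
    using eventually_ge_at_top[of 1]
  proof eventually_elim
    case (elim N)
    show ?case
    proof
      fix P :: "(int ^ 'n) set" assume "P \<in> int_boxes N"
      from density_in_shift[OF this elim(2) shift] elim(1)
      show "density_in (Q_set (cube c s) L) P \<le> density_in (Q_set (cube c' s') L) P + \<epsilon>"
        by simp
    qed
  qed
qed

text \<open>Both grids are finite, so a single threshold for \<open>N\<close> serves all pairs of
  cubes.\<close>

lemma grid_density_le_eventually:
  fixes L :: "real ^ 'n ^ 'm"
  assumes "nonresonant L" "0 < K" "K < K'" "\<epsilon> > 0"
  shows "\<forall>\<^sub>F N in sequentially. \<forall>P\<in>int_boxes N. \<forall>i\<in>grid K. \<forall>j\<in>grid K'.
    density_in (Q_set (grid_cube K' j) L) P \<le> density_in (Q_set (grid_cube K i) L) P + \<epsilon>"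
proof -
  have "1 / real K' < 1 / real K" using assms by (simp add: frac_less2)
  then have "\<forall>\<^sub>F N in sequentially. \<forall>i\<in>grid K. \<forall>j\<in>grid K'. \<forall>P\<in>int_boxes N.
      density_in (Q_set (grid_cube K' j) L) P \<le> density_in (Q_set (grid_cube K i) L) P + \<epsilon>"
    unfolding grid_cube_def
    by (intro eventually_ball_finite finite_grid ballI cube_density_le_eventually assms)
  then show ?thesis by eventually_elim blast
qed

lemma density_UN_grid_cubes:
  assumes "K > 0" "finite P" "I \<subseteq> grid K"
  shows "density_in (\<Union>i\<in>I. Q_set (grid_cube K i) L) P =
    (\<Sum>i\<in>I. density_in (Q_set (grid_cube K i) L) P)"
proof (rule density_in_UN)
  show "finite I" using assms(3) finite_grid finite_subset by blast
  show "disjoint_family_on (\<lambda>i. Q_set (grid_cube K i) L) I"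
    unfolding disjoint_family_on_def
  proof (intro ballI impI)
    fix i j assume "i \<in> I" "j \<in> I" "i \<noteq> j"
    with assms show "Q_set (grid_cube K i) L \<inter> Q_set (grid_cube K j) L = {}"
      by (intro disjoint_Q_set_subset_cell[OF cell_unit_cube] disjoint_grid_cubes
          grid_cube_subset_unit) auto
  qed
qed fact

lemma Q_set_cell: "cell V \<Longrightarrow> Q_set V L = UNIV"
  unfolding cell_iff set_eq_iff Q_set_iff by blast

text \<open>The grid cubes tile the unit cube, which is a cell, so every integer point visits
  exactly one of them.\<close>

lemma sum_grid_density:
  assumes "K > 0" "finite P" "card P > 0"
  shows "(\<Sum>i\<in>grid K. density_in (Q_set (grid_cube K i) L) P) = 1"
proof -
  have "(\<Sum>i\<in>grid K. density_in (Q_set (grid_cube K i) L) P) =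
      density_in (Q_set (\<Union>i\<in>grid K. grid_cube K i) L) P"
    using assms by (simp add: density_UN_grid_cubes Q_set_UN)
  also have "\<dots> = 1"
    using assms by (simp add: UN_grid_cube Q_set_cell[OF cell_unit_cube] density_in_UNIV)
  finally show ?thesis .
qed

lemma grid_density_bounds_eventually:
  fixes L :: "real ^ 'n ^ 'm"
  assumes "nonresonant L" "2 \<le> K" "\<epsilon> > 0"
  shows "\<forall>\<^sub>F N in sequentially. \<forall>P\<in>int_boxes N. \<forall>i\<in>grid K.
    1 / real (K + 1) ^ CARD('m) - \<epsilon> \<le> density_in (Q_set (grid_cube K i) L) P \<and>
    density_in (Q_set (grid_cube K i) L) P \<le> 1 / real (K - 1) ^ CARD('m) + \<epsilon>"
proof -
  let ?d = "\<lambda>K i. density_in (Q_set (grid_cube K i) L)"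
  have "\<forall>\<^sub>F N in sequentially. \<forall>P\<in>int_boxes N. \<forall>i\<in>grid K. \<forall>j\<in>grid (K + 1).
      ?d (K + 1) j P \<le> ?d K i P + \<epsilon>"
    by (rule grid_density_le_eventually) (use assms in auto)
  moreover have "\<forall>\<^sub>F N in sequentially. \<forall>P\<in>int_boxes N. \<forall>i\<in>grid (K - 1). \<forall>j\<in>grid K.
      ?d K j P \<le> ?d (K - 1) i P + \<epsilon>"
    by (rule grid_density_le_eventually) (use assms in auto)
  ultimately show ?thesis
    using eventually_ge_at_top[of 1]
  proof eventually_elim
    case (elim N)
    show ?case
    proof (intro ballI conjI)
      fix P :: "(int ^ 'n) set" and i :: "int ^ 'm"
      assume P: "P \<in> int_boxes N" and i: "i \<in> grid K"
      have fin: "finite P" "card P > 0"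
        using P elim(3) by (auto intro: int_boxes_finite int_boxes_card_pos)
      have "1 = (\<Sum>j\<in>grid (K + 1). ?d (K + 1) j P)"
        by (rule sum_grid_density[symmetric]) (use fin in auto)
      \<comment> \<open>Each of the (K + 1)^m smaller cubes has density at most that of cube
        \<open>i\<close> plus \<epsilon>. The upper bound below argues symmetrically with the (K -
        1)^m larger cubes.\<close>
      also have "\<dots> \<le> of_nat (card (grid (K + 1) :: (int ^ 'm) set)) * (?d K i P + \<epsilon>)"
        by (rule sum_bounded_above) (use elim(1) P i in blast)
      finally have "1 / real (K + 1) ^ CARD('m) \<le> ?d K i P + \<epsilon>"
        by (simp add: card_grid divide_le_eq mult.commute)
      then show "1 / real (K + 1) ^ CARD('m) - \<epsilon> \<le> ?d K i P" by simp
      have "of_nat (card (grid (K - 1) :: (int ^ 'm) set)) * (?d K i P - \<epsilon>) \<le>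
          (\<Sum>j\<in>grid (K - 1). ?d (K - 1) j P)"
        by (rule sum_bounded_below) (use elim(2) P i in force)
      also have "\<dots> = 1"
        by (rule sum_grid_density) (use fin assms in auto)
      finally have "?d K i P - \<epsilon> \<le> 1 / real (K - 1) ^ CARD('m)"
        using assms(2) by (simp add: card_grid le_divide_eq mult.commute)
      then show "?d K i P \<le> 1 / real (K - 1) ^ CARD('m) + \<epsilon>" by simp
    qed
  qed
qed

section \<open>Squeezing Jordan measurable sets between unions of grid cubes\<close>

definition inner_grid :: "(real ^ 'm) set \<Rightarrow> nat \<Rightarrow> (int ^ 'm) set"
  where "inner_grid B K = {i \<in> grid K. grid_cube K i \<subseteq> B}"

definition outer_grid :: "(real ^ 'm) set \<Rightarrow> nat \<Rightarrow> (int ^ 'm) set"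
  where "outer_grid B K = {i \<in> grid K. grid_cube K i \<inter> B \<noteq> {}}"

lemma grid_cube_nonempty:
  assumes "K > 0"
  shows "grid_cube K i \<noteq> {}"
proof -
  have "(1 / K) *\<^sub>R int_vec i \<in> grid_cube K i"
    using assms by (simp add: grid_cube_def cube_def)
  then show ?thesis by blast
qed

lemma inner_grid_subset: "inner_grid B K \<subseteq> grid K"
  by (auto simp: inner_grid_def)

lemma outer_grid_subset: "outer_grid B K \<subseteq> grid K"
  by (auto simp: outer_grid_def)

lemma inner_subset_outer_grid:
  assumes "K > 0"
  shows "inner_grid B K \<subseteq> outer_grid B K"
proof
  fix i assume "i \<in> inner_grid B K"
  then have "i \<in> grid K" "grid_cube K i \<inter> B = grid_cube K i"
    by (auto simp: inner_grid_def)
  then show "i \<in> outer_grid B K"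
    using grid_cube_nonempty[OF assms] by (simp add: outer_grid_def)
qed

lemma finite_inner_grid [simp]: "finite (inner_grid B K)"
  by (rule finite_subset[OF inner_grid_subset finite_grid])

lemma finite_outer_grid [simp]: "finite (outer_grid B K)"
  by (rule finite_subset[OF outer_grid_subset finite_grid])

lemma UN_inner_outer_grid:
  assumes "K > 0"
  shows "(\<Union>i\<in>inner_grid B K. grid_cube K i) \<subseteq> cube 0 1 \<inter> B"
    "cube 0 1 \<inter> B \<subseteq> (\<Union>i\<in>outer_grid B K. grid_cube K i)"
  unfolding UN_grid_cube[OF assms, symmetric] by (auto simp: inner_grid_def outer_grid_def)

text \<open>A cube that meets \<open>B\<close> without lying in it touches the frontier of some
  translate of \<open>G\<close>. The relevant frontiers form a compact null set, so for large
  \<open>K\<close> all such cubes lie in an open set of measure at most \<epsilon>, which bounds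
  their total volume.\<close>

lemma Jordan_grid_boundary_eventually:
  fixes G :: "(real ^ 'm) set"
  assumes "Jordan_measurable G" "\<epsilon> > 0"
  defines "B \<equiv> G + range int_vec"
  shows "\<forall>\<^sub>F K in sequentially. card (outer_grid B K - inner_grid B K) / K ^ CARD('m) \<le> \<epsilon>"
proof -
  obtain b where b: "\<And>u. u \<in> G \<Longrightarrow> norm u \<le> b"
    using assms(1) by (auto simp: Jordan_measurable_def bounded_iff)
  \<comment> \<open>These finitely many lattice vectors include all \<open>z\<close> whose translate
    of \<open>G\<close> meets the unit cube; finiteness keeps \<open>Fr\<close> compact and
    negligible.\<close>
  define F :: "(int ^ 'm) set" where "F = {z. \<forall>k. z $ k \<in> {-\<lceil>b\<rceil> - 1..\<lceil>b\<rceil> + 1}}"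
  define Fr where "Fr = (\<Union>z\<in>F. (+) (int_vec z) ` frontier G)"
  have finF: "finite F" unfolding F_def by (rule finite_vec_box) simp
  have neg: "negligible (frontier G)"
    using assms(1) by (simp add: Jordan_measurable_def negligible_iff_null_sets)
  have negFr: "negligible Fr"
    unfolding Fr_def using finF neg by (auto intro!: negligible_Union negligible_translation)
  have compact: "compact Fr"
    unfolding Fr_def using finF assms(1)
    by (auto intro!: compact_UN compact_translation simp: Jordan_measurable_def)
  have Fr_leb: "Fr \<in> sets lebesgue" using negFr by (simp add: negligible_imp_sets)
  obtain T where T: "open T" "Fr \<subseteq> T" "T - Fr \<in> lmeasurable" "emeasure lebesgue (T - Fr) < ennreal \<epsilon>"
    using sets_lebesgue_outer_open[OF Fr_leb assms(2)] by metis
  have TFr: "T = (T - Fr) \<union> Fr" using T(2) by blast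
  have Tm: "T \<in> lmeasurable"
    using T(3) negligible_imp_measurable[OF negFr] TFr by (metis fmeasurable.Un)
  have "measure lebesgue T = measure lebesgue (T - Fr)"
    using negFr by (simp add: measure_Diff_null_set negligible_iff_null_sets fmeasurableD Tm)
  also have "\<dots> \<le> \<epsilon>"
    using T(4) assms(2) by (simp add: emeasure_eq_measure2[OF T(3)] ennreal_less_iff)
  finally have mT: "measure lebesgue T \<le> \<epsilon>" .
  \<comment> \<open>Compactness of \<open>Fr\<close> gives one radius for all its points; cubes of
    diameter below \<open>e\<close> that touch \<open>Fr\<close> then stay in
    \<open>T\<close>.\<close>
  obtain e where e: "e > 0" "(\<Union>x\<in>Fr. ball x e) \<subseteq> T"
    using compact_subset_open_imp_ball_epsilon_subset[OF compact T(1,2)] by blast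
  have touch: "grid_cube K i \<inter> Fr \<noteq> {}" if i: "K > 0" "i \<in> outer_grid B K - inner_grid B K" for K i
  proof -
    obtain u where u: "u \<in> grid_cube K i" "u \<in> B" using i by (auto simp: outer_grid_def)
    obtain v where v: "v \<in> grid_cube K i" "v \<notin> B" using i by (auto simp: outer_grid_def inner_grid_def)
    obtain g z where g: "g \<in> G" "u = int_vec z + g"
      using u(2) by (auto simp: B_def set_plus_def add.commute)
    have "u \<in> cube 0 1" using i u grid_cube_subset_unit by (auto simp: outer_grid_def)
    have "z \<in> F"
      unfolding F_def
    proof (intro CollectI allI)
      fix k
      have "0 \<le> z $ k + g $ k \<and> z $ k + g $ k < 1"
        using \<open>u \<in> cube 0 1\<close> g(2) by (auto simp: cube_def)
      moreover have "\<bar>g $ k\<bar> \<le> b"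
        using component_le_norm_cart[of g k] b[OF g(1)] by simp
      ultimately show "z $ k \<in> {-\<lceil>b\<rceil> - 1..\<lceil>b\<rceil> + 1}" by auto linarith+
    qed
    \<comment> \<open>The cube is connected, contains \<open>u\<close> in this translate of
      \<open>G\<close>, and contains \<open>v\<close> outside \<open>B\<close>, hence outside the
      translate.\<close>
    have "grid_cube K i \<inter> frontier ((+) (int_vec z) ` G) \<noteq> {}"
    proof (rule connected_Int_frontier)
      show "connected (grid_cube K i)" by (simp add: grid_cube_def connected_cube)
      show "grid_cube K i \<inter> (+) (int_vec z) ` G \<noteq> {}" using u(1) g by blast
      have "(+) (int_vec z) ` G \<subseteq> B" by (auto simp: B_def add.commute[of "int_vec z"])
      then show "grid_cube K i - (+) (int_vec z) ` G \<noteq> {}" using v by blast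
    qed
    then show ?thesis using \<open>z \<in> F\<close> unfolding Fr_def frontier_translation by blast
  qed
  have "(\<lambda>K. CARD('m) / real K) \<longlonglongrightarrow> 0" by (rule lim_const_over_n)
  then have "\<forall>\<^sub>F K in sequentially. CARD('m) / real K < e" using e(1) by (rule order_tendstoD)
  then show ?thesis
    using eventually_gt_at_top[of 0]
  proof eventually_elim
    case (elim K)
    let ?I = "outer_grid B K - inner_grid B K"
    have "grid_cube K i \<subseteq> T" if i: "i \<in> ?I" for i
    proof
      fix u assume u: "u \<in> grid_cube K i"
      obtain p where p: "p \<in> grid_cube K i" "p \<in> Fr" using touch[OF elim(2) i] by blast
      then have "u \<in> ball p e" using dist_grid_cube_le[OF p(1) u] elim(1) by simp
      then show "u \<in> T" using e(2) p(2) by blast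
    qed
    then have "measure lebesgue (\<Union>i\<in>?I. grid_cube K i) \<le> measure lebesgue T"
      by (intro measure_mono_fmeasurable Tm sets.finite_UN) (auto simp: grid_cube_def fmeasurableD)
    then show ?case
      using mT elim(2) by (simp add: measure_UN_grid_cubes)
  qed
qed

lemma Jordan_periodization_measurable:
  fixes G :: "(real ^ 'm) set"
  assumes "Jordan_measurable G"
  shows "G + range int_vec \<in> sets lebesgue"
proof -
  have "G \<in> lmeasurable"
    using assms by (intro measurable_Jordan) (auto simp: Jordan_measurable_def negligible_iff_null_sets)
  then have "(+) (int_vec z) ` G \<in> sets lebesgue" for z
    by (intro lebesgue_sets_translation fmeasurableD)
  moreover have "G + range int_vec = (\<Union>z. (+) (int_vec z) ` G)"
    by (auto simp: set_plus_def add.commute image_iff)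
  ultimately show ?thesis
    using sets.countable_UN'[of UNIV "\<lambda>z. (+) (int_vec z) ` G" lebesgue] by simp
qed

text \<open>First \<open>K\<close> is fixed, then \<open>N\<close> is taken large for it. The three
  errors of size \<epsilon> come from the boundary cubes, from replacing K by K + 1 or K - 1 in the
  volume of a cube, and from the density estimates summed over the cubes.\<close>

lemma Q_set_density_eventually:
  fixes L :: "real ^ 'n ^ 'm"
  assumes "nonresonant L" "Jordan_measurable G" "\<epsilon> > 0"
  defines "B \<equiv> G + range int_vec"
  shows "\<exists>N\<ge>1. \<forall>P\<in>int_boxes N.
    \<bar>density_in (Q_set G L) P - measure lebesgue (cube 0 1 \<inter> B)\<bar> \<le> 3 * \<epsilon>"
proof -
  let ?\<mu> = "measure lebesgue (cube 0 1 \<inter> B)" and ?m = "CARD('m)"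
  have "(\<lambda>K. (real K / real (K + 1)) ^ ?m) \<longlonglongrightarrow> 1 ^ ?m"
    by (intro tendsto_power) real_asymp
  then have "\<forall>\<^sub>F K in sequentially. (real K / real (K + 1)) ^ ?m > 1 - \<epsilon>"
    by (rule order_tendstoD) (use assms(3) in simp)
  moreover have "(\<lambda>K. (real K / real (K - 1)) ^ ?m) \<longlonglongrightarrow> 1 ^ ?m"
    by (intro tendsto_power) real_asymp
  then have "\<forall>\<^sub>F K in sequentially. (real K / real (K - 1)) ^ ?m < 1 + \<epsilon>"
    by (rule order_tendstoD) (use assms(3) in simp)
  moreover note Jordan_grid_boundary_eventually[OF assms(2,3), folded B_def]
  moreover note eventually_ge_at_top[of "2::nat"]
  ultimately have "\<forall>\<^sub>F K in sequentially. (real K / real (K + 1)) ^ ?m > 1 - \<epsilon> \<and>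
      (real K / real (K - 1)) ^ ?m < 1 + \<epsilon> \<and>
      card (outer_grid B K - inner_grid B K) / K ^ ?m \<le> \<epsilon> \<and> 2 \<le> K"
    by (simp only: eventually_conj_iff)
  then obtain K where K: "(real K / real (K + 1)) ^ ?m > 1 - \<epsilon>"
      "(real K / real (K - 1)) ^ ?m < 1 + \<epsilon>"
      "card (outer_grid B K - inner_grid B K) / K ^ ?m \<le> \<epsilon>" "2 \<le> K"
    by (auto dest: eventually_happens)
  define M where "M = real K ^ ?m"
  \<comment> \<open>\<open>p\<close> and \<open>q\<close> are the volumes of the inner and outer
    unions of cubes; they enclose the measure sought and differ by at most \<epsilon>.\<close>
  define p where "p = real (card (inner_grid B K)) / M"
  define q where "q = real (card (outer_grid B K)) / M"
  have K0: "K > 0" using K(4) by simp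
  have M: "M > 0" using K(4) by (simp add: M_def)
  have B_leb: "B \<in> sets lebesgue"
    unfolding B_def by (rule Jordan_periodization_measurable) fact
  have qp: "q - p \<le> \<epsilon>"
    using K(3) inner_subset_outer_grid[OF K0, of B]
    by (simp add: card_Diff_subset of_nat_diff card_mono p_def q_def M_def diff_divide_distrib)
  have "card (outer_grid B K) \<le> card (grid K :: (int ^ 'm) set)"
    by (intro card_mono outer_grid_subset finite_grid)
  then have "real (card (outer_grid B K)) \<le> M"
    by (simp add: card_grid M_def flip: of_nat_power)
  then have q1: "q \<le> 1" using M by (simp add: q_def)
  have p0: "0 \<le> p" "0 \<le> q" using M by (simp_all add: p_def q_def)
  have "p = measure lebesgue (\<Union>i\<in>inner_grid B K. grid_cube K i)"
    using K0 by (simp add: p_def M_def measure_UN_grid_cubes)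
  also have "\<dots> \<le> ?\<mu>"
    using B_leb by (intro measure_mono_fmeasurable UN_inner_outer_grid K0 fmeasurable_Int_fmeasurable
        sets.finite_UN) (auto simp: grid_cube_def fmeasurableD)
  finally have p\<mu>: "p \<le> ?\<mu>" .
  have "?\<mu> \<le> measure lebesgue (\<Union>i\<in>outer_grid B K. grid_cube K i)"
    using B_leb by (intro measure_mono_fmeasurable UN_inner_outer_grid K0 sets.Int
        fmeasurable.finite_UN) (auto simp: grid_cube_def fmeasurableD)
  also have "\<dots> = q"
    using K0 by (simp add: q_def M_def measure_UN_grid_cubes)
  finally have \<mu>q: "?\<mu> \<le> q" .
  \<comment> \<open>The tolerance per cube is \<open>\<epsilon> / M\<close> because up to
    \<open>M\<close> cubes are summed.\<close>
  have "\<forall>\<^sub>F N in sequentially. (\<forall>P\<in>int_boxes N. \<forall>i\<in>grid K.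
      1 / real (K + 1) ^ ?m - \<epsilon> / M \<le> density_in (Q_set (grid_cube K i) L) P \<and>
      density_in (Q_set (grid_cube K i) L) P \<le> 1 / real (K - 1) ^ ?m + \<epsilon> / M) \<and> 1 \<le> N"
    using assms M K(4)
    by (intro eventually_conj grid_density_bounds_eventually eventually_ge_at_top) simp_all
  then obtain N where N: "\<And>P i. P \<in> int_boxes N \<Longrightarrow> i \<in> grid K \<Longrightarrow>
      1 / real (K + 1) ^ ?m - \<epsilon> / M \<le> density_in (Q_set (grid_cube K i) L) P \<and>
      density_in (Q_set (grid_cube K i) L) P \<le> 1 / real (K - 1) ^ ?m + \<epsilon> / M" and "1 \<le> N"
    unfolding eventually_sequentially by blast
  have "\<bar>density_in (Q_set G L) P - ?\<mu>\<bar> \<le> 3 * \<epsilon>" if P: "P \<in> int_boxes N" for P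
  proof -
    let ?d = "\<lambda>i. density_in (Q_set (grid_cube K i) L) P"
    have fin: "finite P" using P by (rule int_boxes_finite)
    have "p * (1 - \<epsilon>) - \<epsilon> \<le> p * (real K / real (K + 1)) ^ ?m - p * \<epsilon>"
      using K(1) p0 qp q1 p\<mu> \<mu>q assms(3)
      by (intro diff_mono mult_left_mono) (auto simp: mult_left_le_one_le)
    also have "\<dots> = of_nat (card (inner_grid B K)) * (1 / real (K + 1) ^ ?m - \<epsilon> / M)"
      using M by (simp add: p_def M_def power_divide field_simps)
    also have "\<dots> \<le> (\<Sum>i\<in>inner_grid B K. ?d i)"
      using N[OF P] inner_grid_subset by (intro sum_bounded_below) blast
    also have "\<dots> = density_in (\<Union>i\<in>inner_grid B K. Q_set (grid_cube K i) L) P"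
      by (rule density_UN_grid_cubes[OF K0 fin inner_grid_subset, symmetric])
    also have "\<dots> \<le> density_in (Q_set G L) P"
    proof (rule density_in_mono[OF fin], rule subsetI)
      fix x assume "x \<in> (\<Union>i\<in>inner_grid B K. Q_set (grid_cube K i) L)"
      then obtain z where "L *v int_vec x + int_vec z \<in> B"
        by (auto simp: Q_set_iff inner_grid_def)
      then show "x \<in> Q_set G L"
        unfolding B_def plus_range_int_vec_periodic by (simp add: Q_set_def)
    qed
    finally have lower: "p * (1 - \<epsilon>) - \<epsilon> \<le> density_in (Q_set G L) P" .
    have "density_in (Q_set G L) P \<le> density_in (\<Union>i\<in>outer_grid B K. Q_set (grid_cube K i) L) P"
    proof (rule density_in_mono[OF fin], rule subsetI)
      fix x assume "x \<in> Q_set G L"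
      then have "L *v int_vec x \<in> B" by (simp add: Q_set_def B_def)
      moreover obtain z where z: "L *v int_vec x + int_vec z \<in> cube 0 1"
        using cell_unit_cube unfolding cell_iff by blast
      ultimately have "L *v int_vec x + int_vec z \<in> cube 0 1 \<inter> B"
        by (simp add: B_def plus_range_int_vec_periodic)
      then show "x \<in> (\<Union>i\<in>outer_grid B K. Q_set (grid_cube K i) L)"
        using UN_inner_outer_grid(2)[OF K0] unfolding UN_iff Q_set_iff by blast
    qed
    also have "\<dots> = (\<Sum>i\<in>outer_grid B K. ?d i)"
      by (rule density_UN_grid_cubes[OF K0 fin outer_grid_subset])
    also have "\<dots> \<le> of_nat (card (outer_grid B K)) * (1 / real (K - 1) ^ ?m + \<epsilon> / M)"
      using N[OF P] outer_grid_subset by (intro sum_bounded_above) blast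
    also have "\<dots> = q * (real K / real (K - 1)) ^ ?m + q * \<epsilon>"
      using M by (simp add: q_def M_def power_divide field_simps)
    also have "\<dots> \<le> q * (1 + \<epsilon>) + \<epsilon>"
      using K(2) p0 q1 assms(3) by (intro add_mono mult_left_mono) (auto simp: mult_left_le_one_le)
    finally have upper: "density_in (Q_set G L) P \<le> q * (1 + \<epsilon>) + \<epsilon>" .
    have "p * \<epsilon> \<le> \<epsilon>" "q * \<epsilon> \<le> \<epsilon>"
      using p0 p\<mu> \<mu>q q1 assms(3) by (auto simp: mult_left_le_one_le)
    then show ?thesis
      using lower upper p\<mu> \<mu>q qp by (simp add: algebra_simps)
  qed
  then show ?thesis using \<open>1 \<le> N\<close> by blast
qed

theorem theorem3:
  fixes L :: "real ^ 'n ^ 'm" and G :: "(real ^ 'm) set"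
  assumes "nonresonant L"
    and "Jordan_measurable G"
  shows "frequency_measurable (Q_set G L) \<and>
    (\<forall>V. V \<in> sets lebesgue \<and> cell V \<longrightarrow>
      frequency (Q_set G L) = measure lebesgue (V \<inter> (G + range int_vec)))"
proof -
  let ?\<mu> = "measure lebesgue (cube 0 1 \<inter> (G + range int_vec))"
  have "\<exists>N\<ge>1. \<forall>P\<in>int_boxes N. \<bar>density_in (Q_set G L) P - ?\<mu>\<bar> \<le> \<epsilon>" if "\<epsilon> > 0" for \<epsilon>
    using Q_set_density_eventually[OF assms, of "\<epsilon> / 3"] that by simp
  note freq = frequency_eqI[OF this]
  \<comment> \<open>The periodization of \<open>G\<close> has the same measure in every measurable
    cell, so the unit cube may stand for \<open>V\<close>.\<close>
  have "measure lebesgue (V \<inter> (G + range int_vec)) = ?\<mu>" if "V \<in> sets lebesgue" "cell V" for V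
    unfolding measure_def
    by (simp only: emeasure_cell_Int_periodic[OF that _ cell_unit_cube
          Jordan_periodization_measurable[OF assms(2)] plus_range_int_vec_periodic]
        fmeasurableD[OF cube_lmeasurable])
  then show ?thesis
    by (simp add: frequency_measurable_def frequency_def freq)
qed

end
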